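(* For each $\eta\in(0,1)$ there is a constant $K_{\eta}$ such that, for every integer $n\ge 2$, there is an oriented graph $D$ on $n$ vertices, none of which is isolated, with $bias_{\eta}(D)\le K_{\eta}\,n/\log_{2} n$.
   Context: An oriented graph $D$ is a finite directed graph without loops in which, for each pair of distinct vertices $x,y$, at most one of $\vec{xy},\vec{yx}$ is an arc. A vertex is isolated if it is incident to no arc. For (not necessarily disjoint) $A,B\subseteq V(D)$, $e(A,B)$ is the number of arcs $\vec{xy}$ of $D$ with $x\in A$, $y\in B$. For $\eta\in(0,1)$ define $bias_{\eta}(D)=\max\{e(A,B): A,B\subseteq V(D),\ e(B,A)\le \eta\, e(A,B)\}$. *)

theory Defs
  imports Complex_Main "Graph_Theory.Pair_Digraph"
begin

locale oriented_graph = pair_digraph D for D :: "'a pair_pre_digraph" +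
  assumes no_opposite_arcs:
    "x \<noteq> y \<Longrightarrow> (x, y) \<in> parcs D \<Longrightarrow> (y, x) \<notin> parcs D"

definition isolated :: "'a pair_pre_digraph \<Rightarrow> 'a \<Rightarrow> bool" where
  "isolated D v \<longleftrightarrow> v \<in> pverts D \<and> (\<forall>a \<in> parcs D. fst a \<noteq> v \<and> snd a \<noteq> v)"

definition arcs_from_to :: "'a pair_pre_digraph \<Rightarrow> 'a set \<Rightarrow> 'a set \<Rightarrow> nat" where
  "arcs_from_to D A B = card {(x, y) \<in> parcs D. x \<in> A \<and> y \<in> B}"

definition bias_values :: "real \<Rightarrow> 'a pair_pre_digraph \<Rightarrow> nat set" where
  "bias_values \<eta> D =
    {arcs_from_to D A B | A B. A \<subseteq> pverts D \<and> B \<subseteq> pverts D \<and>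
       real (arcs_from_to D B A) \<le> \<eta> * real (arcs_from_to D A B)}"

definition bias :: "real \<Rightarrow> 'a pair_pre_digraph \<Rightarrow> nat" where
  "bias \<eta> D = Max (bias_values \<eta> D)"

text \<open>\<^const>\<open>Max\<close> is unspecified on empty and on infinite sets; neither case arises here.\<close>

lemma bias_values_nonempty: "bias_values \<eta> D \<noteq> {}"
proof -
  have "arcs_from_to D {} {} \<in> bias_values \<eta> D"
    unfolding bias_values_def
    by (rule CollectI, rule exI[of _ "{}"], rule exI[of _ "{}"]) (simp add: arcs_from_to_def)
  then show ?thesis by blast
qed

lemma (in pair_fin_digraph) finite_bias_values: "finite (bias_values \<eta> G)"
proof (rule finite_subset)
  show "bias_values \<eta> G \<subseteq> (\<lambda>(A, B). arcs_from_to G A B) ` (Pow (pverts G) \<times> Pow (pverts G))"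
    by (auto simp: bias_values_def)
  show "finite ((\<lambda>(A, B). arcs_from_to G A B) ` (Pow (pverts G) \<times> Pow (pverts G)))"
    using pair_finite_verts by blast
qed

end

theory Submission
  imports Defs "HOL-Library.Indicator_Function" "HOL-Computational_Algebra.Primes"
    "HOL-Number_Theory.Cong"
begin

text \<open>The graph is bipartite, between the residues modulo a prime p and vertices (h, i), where h is a
  cubic polynomial map modulo p and i ranges over about log p scales; (h, i) sends arcs to those x
  with h x in a fixed interval of length 2 ^ i and receives arcs from those x with h x in the next
  interval of that length. Hence (h, i) has degree about 2 ^ (i + 1). Given a set U of residues, put
  t = |U| 2 ^ i / p. If t is small, few vertices (h, i) have neighbours in U at all. If t is large,
  then, since the values of a random cubic at four points are independent, a fourth moment bound
  shows that the numbers of in- and out-neighbours in U are nearly always comparable. The average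
  of the excess of one over l times the other (l > 1) is O(min t (1 / t)) at each scale, and the sum
  over all scales is O(1) rather than of the order of the number of scales. Blowing up the
  vertices (h, i) to n vertices altogether, with p a small power of n, gives bias
  O(n / log n).\<close>

section \<open>Primes between powers of two\<close>

text \<open>By Leibniz's harmonic triangle, 1 / (k * (n choose k)) is an integral combination of
  1, 1/2, ..., 1/n.\<close>

lemma Suc_times_binomial_dvd_Lcm:
  "k < n \<Longrightarrow> n \<le> N \<Longrightarrow> Suc k * (n choose Suc k) dvd Lcm {1..N::nat}"
proof (induction k arbitrary: n)
  case 0
  then show ?case by (auto intro!: dvd_Lcm)
next
  case (Suc k)
  obtain m where n: "n = Suc m" "k < m" using Suc.prems by (cases n) auto
  define L where "L = int (Lcm {1..N})"
  define X where "X = int (Suc k * (n choose Suc k))"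
  define Y where "Y = int (Suc k * (m choose Suc k))"
  define Z where "Z = int (Suc (Suc k) * (n choose Suc (Suc k)))"
  have "X dvd L" "Y dvd L"
    unfolding X_def Y_def L_def int_dvd_int_iff using Suc.prems n by (intro Suc.IH; simp)+
  then obtain a b where a: "L = X * a" and b: "L = Y * b" by (meson dvdE)
  have X: "X = int n * int (m choose k)" unfolding X_def n Suc_times_binomial by (simp only: of_nat_mult)
  have Z: "Z = int n * int (m choose Suc k)" unfolding Z_def n Suc_times_binomial by (simp only: of_nat_mult)
  have "Suc k * (m choose Suc k) = (m - k) * (m choose k)"
    by (metis binomial_absorb_comp binomial_absorption)
  then have Y: "Y = (int m - int k) * int (m choose k)"
    unfolding Y_def using n(2) by (metis int_ops(7) less_imp_le of_nat_diff)
  \<comment> \<open>Since \<open>b = L / Y\<close> and \<open>a = L / X\<close>, the aim is the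
    recurrence 1 / Z = 1 / Y - 1 / X of the triangle. Because \<open>n = m + 1\<close>, the
    coefficients \<open>n\<close> and \<open>m - k\<close> of \<open>L\<close> differ by exactly
    \<open>k + 1\<close>, which cancels.\<close>
  have "(int k + 1) * (Z * b) = int n * L" unfolding b Z Y_def by (simp add: algebra_simps)
  moreover have "(int k + 1) * (Z * a) = (int m - int k) * L"
  proof -
    have "(int k + 1) * (Z * a) = int n * Y * a" unfolding Z Y_def by (simp add: algebra_simps)
    also have "\<dots> = (int m - int k) * L" unfolding a X Y by simp
    finally show ?thesis .
  qed
  ultimately have "(int k + 1) * (Z * (b - a)) = (int k + 1) * L"
    by (simp add: right_diff_distrib n algebra_simps)
  then have "L = Z * (b - a)" by simp
  then have "Z dvd L" by (rule dvdI)
  then show ?case unfolding Z_def L_def int_dvd_int_iff .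
qed

lemma Lcm_atLeastAtMost_pos: "Lcm {1..N::nat} > 0"
proof -
  have "Lcm {1..N} \<noteq> 0" by (subst Lcm_0_iff_nat) auto
  then show ?thesis by blast
qed

text \<open>The multiplicity of \<open>q\<close> in a least common multiple is the maximum of its
  multiplicities in the members, so a single member attains it.\<close>

lemma prime_power_dvd_Lcm:
  fixes A :: "nat set"
  assumes "finite A" "0 \<notin> A" "prime q" "q ^ k dvd Lcm A" "k > 0"
  shows "\<exists>a\<in>A. q ^ k dvd a"
  using assms
proof (induction A)
  case empty
  then show ?case by (auto simp: prime_nat_iff)
next
  case (insert a A)
  have nz: "a \<noteq> 0" "Lcm A \<noteq> 0" using insert by (auto simp: Lcm_0_iff_nat)
  have q: "\<not> is_unit q" using insert.prems by (simp add: prime_nat_iff)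
  have "k \<le> multiplicity q (lcm a (Lcm A))"
    using insert.prems nz q by (simp add: power_dvd_iff_le_multiplicity)
  also have "\<dots> = max (multiplicity q a) (multiplicity q (Lcm A))"
    using nz insert.prems by (simp add: multiplicity_lcm)
  finally have "q ^ k dvd a \<or> q ^ k dvd Lcm A"
    using nz q by (auto simp: power_dvd_iff_le_multiplicity le_max_iff_disj)
  then show ?case using insert by auto
qed

text \<open>Each full prime power in the factorization of the \<open>Lcm\<close> divides a single
  number up to \<open>N\<close>, hence is at most \<open>N\<close>; there is one such factor for
  each prime involved.\<close>

lemma Lcm_atMost_le_power:
  assumes "N \<ge> 1"
  shows "Lcm {1..N::nat} \<le> N ^ card {q. prime q \<and> q \<le> N}"
proof -
  let ?L = "Lcm {1..N}"
  have nz: "?L \<noteq> 0" using Lcm_atLeastAtMost_pos[of N] by simp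
  have dvd: "\<exists>a\<in>{1..N}. q ^ multiplicity q ?L dvd a" if "q \<in> prime_factors ?L" for q
    using that nz by (intro prime_power_dvd_Lcm)
      (auto simp: multiplicity_dvd in_prime_factors_iff prime_multiplicity_gt_zero_iff)
  have le: "q ^ multiplicity q ?L \<le> N" if "q \<in> prime_factors ?L" for q
    using dvd[OF that] by (auto dest!: dvd_imp_le)
  have sub: "prime_factors ?L \<subseteq> {q. prime q \<and> q \<le> N}"
  proof
    fix q assume q: "q \<in> prime_factors ?L"
    have "q dvd q ^ multiplicity q ?L"
      using q nz by (intro dvd_power) (auto simp: in_prime_factors_iff prime_multiplicity_gt_zero_iff)
    with dvd[OF q] have "q \<le> N" by (auto dest!: dvd_trans dvd_imp_le)
    with q show "q \<in> {q. prime q \<and> q \<le> N}" by auto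
  qed
  have "?L = (\<Prod>q\<in>prime_factors ?L. q ^ multiplicity q ?L)"
    using Lcm_atLeastAtMost_pos by (rule prime_factorization_nat)
  also have "\<dots> \<le> (\<Prod>q\<in>prime_factors ?L. N)" using le by (intro prod_mono) auto
  also have "\<dots> = N ^ card (prime_factors ?L)" by simp
  also have "\<dots> \<le> N ^ card {q. prime q \<and> q \<le> N}"
    using assms sub by (intro power_increasing card_mono) (auto intro: finite_subset[of _ "{..N}"])
  finally show ?thesis .
qed

text \<open>Chebyshev's argument. With no prime in the range, all primes up to
  \<open>N = 2 ^ (2 * j + 2)\<close> would be at most \<open>2 ^ j\<close>, so
  \<open>Lcm {1..N}\<close> would be at most \<open>N ^ (2 ^ j)\<close>. But it is a multiple of
  \<open>k * (N choose k)\<close>, where \<open>N = 2 * k\<close>, and so at least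
  \<open>2 ^ N / 2\<close>, which is larger.\<close>

lemma prime_between_powers_of_2:
  "\<exists>q::nat. prime q \<and> 2 ^ j < q \<and> q \<le> 2 ^ (2 * j + 2)"
proof (rule ccontr)
  assume no: "\<not> ?thesis"
  define k :: nat where "k = 2 ^ (2 * j + 1)"
  define N where "N = 2 * k"
  have N: "N = 2 ^ (2 * j + 2)" by (simp add: N_def k_def)
  have k: "k \<ge> 1" by (simp add: k_def)
  have "{q. prime q \<and> q \<le> N} \<subseteq> {1..2 ^ j}"
    using no by (auto simp: N not_less[symmetric] prime_ge_1_nat)
  then have "card {q. prime q \<and> q \<le> N} \<le> 2 ^ j"
    using card_mono[of "{1..2 ^ j :: nat}"] by auto
  then have "Lcm {1..N} \<le> N ^ (2 ^ j)"
    using Lcm_atMost_le_power[of N] k power_increasing[of _ "2^j" N] by (force simp: N_def)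
  moreover have "k * (N choose k) \<le> Lcm {1..N}"
    using Suc_times_binomial_dvd_Lcm[of "k - 1" N N] k
    by (intro dvd_imp_le) (auto simp: N_def Lcm_atLeastAtMost_pos simp del: One_nat_def)
  moreover have "4 ^ k \<le> 2 * (k * (N choose k))"
  proof -
    have "4 ^ k / (2 * real k) \<le> real (N choose k)"
      using central_binomial_lower_bound[of k] k by (simp add: N_def)
    then have "4 ^ k \<le> real (2 * (k * (N choose k)))" using k by (simp add: field_simps)
    then show ?thesis by (metis of_nat_le_iff of_nat_numeral of_nat_power)
  qed
  ultimately have "4 ^ k \<le> 2 * N ^ (2 ^ j)" by linarith
  also have "\<dots> = 2 ^ ((2 * j + 2) * 2 ^ j + 1)"
    unfolding N power_mult[symmetric] by simp
  finally have "2 ^ N \<le> (2::nat) ^ ((2 * j + 2) * 2 ^ j + 1)"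
    by (simp add: N_def power_mult)
  then have "N \<le> (2 * j + 2) * 2 ^ j + 1" by (rule power_le_imp_le_exp[rotated]) simp
  moreover have "(2 * j + 2) * 2 ^ j + 1 < N"
  proof -
    have "j + 1 \<le> 2 ^ j" by (simp add: Suc_leI)
    then have "(j + 1) * (2 * 2 ^ j) \<le> 2 ^ j * (2 * 2 ^ j)" by (rule mult_right_mono) simp
    then have "(2 * j + 2) * 2 ^ j \<le> 2 * (2 ^ j * 2 ^ j)" by (simp add: algebra_simps)
    moreover have "N = 4 * (2 ^ j * 2 ^ j)" by (simp add: N power_add mult_2)
    moreover have "(1::nat) \<le> 2 ^ j * 2 ^ j" by simp
    ultimately show ?thesis by linarith
  qed
  ultimately show False by simp
qed

section \<open>Moments of sums over random cubic maps\<close>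

text \<open>Functions are collected rather than coefficient vectors: for p = 2 and p = 3, different
  coefficients modulo p can give the same map. Sums over this set, divided by its cardinality, are
  expectations for a uniformly random cubic map.\<close>

definition cubic_maps :: "int \<Rightarrow> (int \<Rightarrow> int) set" where
  "cubic_maps p = {h. \<exists>a b c d. h = (\<lambda>x. (a + b * x + c * x^2 + d * x^3) mod p)}"

lemma cubic_maps_eq_image:
  assumes "p > 0"
  shows "cubic_maps p = (\<lambda>(a, b, c, d) x. (a + b * x + c * x^2 + d * x^3) mod p) `
    ({0..<p} \<times> {0..<p} \<times> {0..<p} \<times> {0..<p})" (is "_ = ?f ` ?S")
proof
  show "cubic_maps p \<subseteq> ?f ` ?S"
  proof
    fix h assume "h \<in> cubic_maps p"
    then obtain a b c d where h: "h = (\<lambda>x. (a + b * x + c * x^2 + d * x^3) mod p)"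
      by (auto simp: cubic_maps_def)
    have "h = ?f (a mod p, b mod p, c mod p, d mod p)" (is "_ = ?f ?t")
    proof
      fix x
      have "[a + b * x + c * x^2 + d * x^3 =
          a mod p + (b mod p) * x + (c mod p) * x^2 + (d mod p) * x^3] (mod p)"
        by (intro cong_add cong_mult cong_refl) (simp_all add: cong_def)
      then show "h x = ?f (a mod p, b mod p, c mod p, d mod p) x"
        by (simp add: h cong_def)
    qed
    then show "h \<in> ?f ` ?S" using assms by (intro image_eqI[of _ _ ?t]) auto
  qed
qed (auto simp: cubic_maps_def)

lemma finite_cubic_maps: "p > 0 \<Longrightarrow> finite (cubic_maps p)"
  by (simp add: cubic_maps_eq_image)

lemma card_cubic_maps_le:
  assumes "p > 0" shows "card (cubic_maps p) \<le> nat p ^ 4"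
proof -
  have "card (cubic_maps p) \<le> card ({0..<p} \<times> {0..<p} \<times> {0..<p} \<times> {0..<p})"
    unfolding cubic_maps_eq_image[OF assms] by (rule card_image_le) simp
  also have "\<dots> = nat p ^ 4" by (simp add: card_cartesian_product power4_eq_xxxx)
  finally show ?thesis .
qed

lemma const_in_cubic_maps: "(\<lambda>_. a mod p) \<in> cubic_maps p"
  unfolding cubic_maps_def
  by (rule CollectI, rule exI[of _ a], intro exI[of _ 0]) simp

lemma card_cubic_maps_pos: "p > 0 \<Longrightarrow> card (cubic_maps p) > 0"
  using finite_cubic_maps const_in_cubic_maps card_gt_0_iff by blast

lemma cubic_maps_mod: "h \<in> cubic_maps p \<Longrightarrow> h x mod p = h x"
  by (auto simp: cubic_maps_def)

lemma cubic_maps_shift: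
  assumes "h \<in> cubic_maps p"
  shows "(\<lambda>z. (h z + s * ((z - u) * (z - v) * (z - w))) mod p) \<in> cubic_maps p"
proof -
  obtain a b c d where h: "h = (\<lambda>x. (a + b * x + c * x^2 + d * x^3) mod p)"
    using assms by (auto simp: cubic_maps_def)
  have "(\<lambda>z. (h z + s * ((z - u) * (z - v) * (z - w))) mod p) =
    (\<lambda>x. ((a - s*u*v*w) + (b + s*(u*v+u*w+v*w)) * x + (c - s*(u+v+w)) * x^2 + (d + s) * x^3) mod p)"
    unfolding h by (rule ext, subst mod_add_left_eq, rule arg_cong[of _ _ "\<lambda>t. t mod p"])
      (simp add: algebra_simps power2_eq_square power3_eq_cube)
  then show ?thesis unfolding cubic_maps_def by blast
qed

lemma bij_betw_cubic_maps_shift: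
  "bij_betw (\<lambda>h z. (h z + s * ((z - u) * (z - v) * (z - w))) mod p) (cubic_maps p) (cubic_maps p)"
proof (rule bij_betw_byWitness[where f' = "\<lambda>h z. (h z + (- s) * ((z - u) * (z - v) * (z - w))) mod p"])
  show "\<forall>h\<in>cubic_maps p. (\<lambda>z. ((h z + s * ((z - u) * (z - v) * (z - w))) mod p
      + (- s) * ((z - u) * (z - v) * (z - w))) mod p) = h"
    by (auto simp: mod_simps cubic_maps_mod fun_eq_iff)
  show "\<forall>h\<in>cubic_maps p. (\<lambda>z. ((h z + (- s) * ((z - u) * (z - v) * (z - w))) mod p
      + s * ((z - u) * (z - v) * (z - w))) mod p) = h"
    by (auto simp: mod_simps cubic_maps_mod fun_eq_iff)
qed (use cubic_maps_shift in blast)+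

lemma bij_betw_affine_mod:
  fixes p :: int
  assumes "p > 0" "coprime q p"
  shows "bij_betw (\<lambda>c. (b + c * q) mod p) {0..<p} {0..<p}"
proof -
  have "inj_on (\<lambda>c. (b + c * q) mod p) {0..<p}"
  proof (rule inj_onI)
    fix c c' assume c: "c \<in> {0..<p}" "c' \<in> {0..<p}" and eq: "(b + c * q) mod p = (b + c' * q) mod p"
    have "[b + c * q = b + c' * q] (mod p)" using eq by (simp add: cong_def)
    then have "[c = c'] (mod p)" using assms(2)
      by (simp add: cong_add_lcancel cong_mult_rcancel)
    then show "c = c'" using c by (simp add: cong_def)
  qed
  moreover have "(\<lambda>c. (b + c * q) mod p) ` {0..<p} \<subseteq> {0..<p}" using assms(1) by auto
  ultimately show ?thesis
    by (simp add: bij_betw_def endo_inj_surj)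
qed

text \<open>Adding s * (z - u) * (z - v) * (z - w) for s = 0, ..., p - 1 preserves the values of h at
  u, v, w and makes its value at x run through all residues.\<close>

lemma sum_cubic_maps_independent:
  fixes F :: "(int \<Rightarrow> int) \<Rightarrow> real" and g :: "int \<Rightarrow> real"
  assumes p: "prime p" and x: "x \<in> {0..<p}" and uvw: "{u, v, w} \<subseteq> {0..<p} - {x}"
    and F: "\<And>h h'. h u = h' u \<Longrightarrow> h v = h' v \<Longrightarrow> h w = h' w \<Longrightarrow> F h = F h'"
  shows "(\<Sum>h\<in>cubic_maps p. F h * g (h x)) =
    (\<Sum>h\<in>cubic_maps p. F h) * ((\<Sum>c\<in>{0..<p}. g c) / p)"
proof -
  have p0: "p > 0" using p by (simp add: prime_gt_0_int)
  define q where "q z = (z - u) * (z - v) * (z - w)" for z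
  have cop: "coprime (x - z) p" if "z \<in> {0..<p} - {x}" for z
  proof -
    have "\<not> p dvd x - z" using that x zdvd_not_zless[of "x - z" p] zdvd_not_zless[of "z - x" p]
      by (metis DiffD1 DiffD2 atLeastLessThan_iff cong_iff_dvd_diff cong_less_imp_eq_int insertI1)
    then show ?thesis using p prime_imp_coprime coprime_commute by blast
  qed
  have q: "coprime (q x) p" unfolding q_def using uvw by (simp add: cop)
  have shift: "(\<Sum>h\<in>cubic_maps p. F h * g (h x)) = (\<Sum>h\<in>cubic_maps p. F h * g ((h x + s * q x) mod p))" for s
  proof -
    have "(\<Sum>h\<in>cubic_maps p. F h * g (h x)) =
      (\<Sum>h\<in>cubic_maps p. F (\<lambda>z. (h z + s * q z) mod p) * g ((h x + s * q x) mod p))"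
      unfolding q_def
      by (rule sum.reindex_bij_betw[OF bij_betw_cubic_maps_shift, symmetric])
    also have "\<dots> = (\<Sum>h\<in>cubic_maps p. F h * g ((h x + s * q x) mod p))"
      by (intro sum.cong refl arg_cong2[of _ _ _ _ "(*)"] F) (auto simp: q_def cubic_maps_mod)
    finally show ?thesis .
  qed
  \<comment> \<open>The sum is the same for all \<open>p\<close> shifts. Adding these copies and
    summing over \<open>s\<close> first turns the second factor into the full sum of
    \<open>g\<close>, whatever \<open>h\<close> is.\<close>
  have "p * (\<Sum>h\<in>cubic_maps p. F h * g (h x)) = (\<Sum>s\<in>{0..<p}. \<Sum>h\<in>cubic_maps p. F h * g (h x))"
    using p0 by simp
  also have "\<dots> = (\<Sum>s\<in>{0..<p}. \<Sum>h\<in>cubic_maps p. F h * g ((h x + s * q x) mod p))"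
    by (intro sum.cong[OF refl] shift)
  also have "\<dots> = (\<Sum>h\<in>cubic_maps p. F h * (\<Sum>s\<in>{0..<p}. g ((h x + s * q x) mod p)))"
    by (subst sum.swap) (simp add: sum_distrib_left)
  also have "\<dots> = (\<Sum>h\<in>cubic_maps p. F h * (\<Sum>c\<in>{0..<p}. g c))"
    by (intro sum.cong refl arg_cong2[of _ _ _ _ "(*)"] sum.reindex_bij_betw bij_betw_affine_mod p0 q)
  also have "\<dots> = (\<Sum>h\<in>cubic_maps p. F h) * (\<Sum>c\<in>{0..<p}. g c)"
    by (simp add: sum_distrib_right)
  finally show ?thesis using p0 by (simp add: field_simps)
qed


text \<open>For \<psi> = \<open>indicator P - l * indicator Q\<close> this is the number of points
  of \<open>U\<close> sent into \<open>P\<close> minus \<open>l\<close> times the number sent into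
  \<open>Q\<close>.\<close>

definition hash_sum :: "(int \<Rightarrow> real) \<Rightarrow> int set \<Rightarrow> (int \<Rightarrow> int) \<Rightarrow> real" where
  "hash_sum \<psi> U h = (\<Sum>x\<in>U. \<psi> (h x))"

text \<open>Here and in the next two lemmas, a power of the hash sum is expanded into products of at
  most three values of \<open>h\<close> at points other than \<open>x\<close>, and each product is
  independent of \<open>h x\<close>. With fewer than three points, one of them is repeated.\<close>

lemma sum_hash_sum_mult:
  assumes "prime p" "x \<in> {0..<p}" "U \<subseteq> {0..<p} - {x}"
  shows "(\<Sum>h\<in>cubic_maps p. hash_sum \<psi> U h * g (h x)) =
    (\<Sum>h\<in>cubic_maps p. hash_sum \<psi> U h) * ((\<Sum>c\<in>{0..<p}. g c) / p)"
proof -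
  have "(\<Sum>h\<in>cubic_maps p. hash_sum \<psi> U h * g (h x)) = (\<Sum>u\<in>U. \<Sum>h\<in>cubic_maps p. \<psi> (h u) * g (h x))"
    unfolding hash_sum_def sum_distrib_right by (rule sum.swap)
  also have "\<dots> = (\<Sum>u\<in>U. (\<Sum>h\<in>cubic_maps p. \<psi> (h u)) * ((\<Sum>c\<in>{0..<p}. g c) / p))"
  proof (rule sum.cong[OF refl])
    fix u assume "u \<in> U"
    with assms show "(\<Sum>h\<in>cubic_maps p. \<psi> (h u) * g (h x)) =
        (\<Sum>h\<in>cubic_maps p. \<psi> (h u)) * ((\<Sum>c\<in>{0..<p}. g c) / p)"
      by (intro sum_cubic_maps_independent[of p x u u u]) auto
  qed
  also have "\<dots> = (\<Sum>h\<in>cubic_maps p. hash_sum \<psi> U h) * ((\<Sum>c\<in>{0..<p}. g c) / p)"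
    unfolding hash_sum_def by (subst sum.swap[of _ _ "cubic_maps p"]) (simp only: sum_distrib_right)
  finally show ?thesis .
qed

lemma sum_hash_sum_power2_mult:
  assumes "prime p" "x \<in> {0..<p}" "U \<subseteq> {0..<p} - {x}"
  shows "(\<Sum>h\<in>cubic_maps p. (hash_sum \<psi> U h)^2 * g (h x)) =
    (\<Sum>h\<in>cubic_maps p. (hash_sum \<psi> U h)^2) * ((\<Sum>c\<in>{0..<p}. g c) / p)"
proof -
  have sq: "(hash_sum \<psi> U h)^2 = (\<Sum>(u, v)\<in>U \<times> U. \<psi> (h u) * \<psi> (h v))" for h
    by (simp add: hash_sum_def power2_eq_square sum_product sum.cartesian_product)
  have "(\<Sum>h\<in>cubic_maps p. (hash_sum \<psi> U h)^2 * g (h x)) =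
      (\<Sum>(u, v)\<in>U \<times> U. \<Sum>h\<in>cubic_maps p. (\<psi> (h u) * \<psi> (h v)) * g (h x))"
    unfolding sq sum_distrib_right by (subst sum.swap) (simp only: split_def)
  also have "\<dots> = (\<Sum>(u, v)\<in>U \<times> U. (\<Sum>h\<in>cubic_maps p. \<psi> (h u) * \<psi> (h v)) * ((\<Sum>c\<in>{0..<p}. g c) / p))"
    unfolding split_def
  proof (rule sum.cong[OF refl])
    fix uv assume "uv \<in> U \<times> U"
    with assms show "(\<Sum>h\<in>cubic_maps p. (\<psi> (h (fst uv)) * \<psi> (h (snd uv))) * g (h x)) =
        (\<Sum>h\<in>cubic_maps p. \<psi> (h (fst uv)) * \<psi> (h (snd uv))) * ((\<Sum>c\<in>{0..<p}. g c) / p)"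
      by (intro sum_cubic_maps_independent[of p x "fst uv" "snd uv" "snd uv"]) auto
  qed
  also have "\<dots> = (\<Sum>h\<in>cubic_maps p. (hash_sum \<psi> U h)^2) * ((\<Sum>c\<in>{0..<p}. g c) / p)"
    unfolding sq by (subst sum.swap[of _ _ "cubic_maps p"]) (simp only: sum_distrib_right split_def)
  finally show ?thesis .
qed

lemma sum_hash_sum_power3_mult:
  assumes "prime p" "x \<in> {0..<p}" "U \<subseteq> {0..<p} - {x}"
  shows "(\<Sum>h\<in>cubic_maps p. (hash_sum \<psi> U h)^3 * g (h x)) =
    (\<Sum>h\<in>cubic_maps p. (hash_sum \<psi> U h)^3) * ((\<Sum>c\<in>{0..<p}. g c) / p)"
proof -
  have cube: "(hash_sum \<psi> U h)^3 = (\<Sum>(u, v, w)\<in>U \<times> U \<times> U. \<psi> (h u) * (\<psi> (h v) * \<psi> (h w)))" for h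
  proof -
    have "(hash_sum \<psi> U h)^3 = (\<Sum>u\<in>U. \<psi> (h u)) * ((\<Sum>v\<in>U. \<psi> (h v)) * (\<Sum>w\<in>U. \<psi> (h w)))"
      by (simp add: hash_sum_def power3_eq_cube)
    also have "\<dots> = (\<Sum>u\<in>U. \<Sum>v\<in>U. \<Sum>w\<in>U. \<psi> (h u) * (\<psi> (h v) * \<psi> (h w)))"
      unfolding sum_product[of "\<lambda>v. \<psi> (h v)" U "\<lambda>w. \<psi> (h w)" U]
      by (subst sum_distrib_right) (simp only: sum_distrib_left)
    finally show ?thesis by (simp add: sum.cartesian_product)
  qed
  have "(\<Sum>h\<in>cubic_maps p. (hash_sum \<psi> U h)^3 * g (h x)) =
      (\<Sum>(u, v, w)\<in>U \<times> U \<times> U. \<Sum>h\<in>cubic_maps p. (\<psi> (h u) * (\<psi> (h v) * \<psi> (h w))) * g (h x))"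
    unfolding cube sum_distrib_right by (subst sum.swap) (simp only: split_def)
  also have "\<dots> = (\<Sum>(u, v, w)\<in>U \<times> U \<times> U. (\<Sum>h\<in>cubic_maps p. \<psi> (h u) * (\<psi> (h v) * \<psi> (h w))) * ((\<Sum>c\<in>{0..<p}. g c) / p))"
    unfolding split_def
  proof (rule sum.cong[OF refl])
    fix t assume "t \<in> U \<times> U \<times> U"
    with assms show "(\<Sum>h\<in>cubic_maps p. (\<psi> (h (fst t)) * (\<psi> (h (fst (snd t))) * \<psi> (h (snd (snd t))))) * g (h x)) =
        (\<Sum>h\<in>cubic_maps p. \<psi> (h (fst t)) * (\<psi> (h (fst (snd t))) * \<psi> (h (snd (snd t))))) *
          ((\<Sum>c\<in>{0..<p}. g c) / p)"
      by (intro sum_cubic_maps_independent[of p x "fst t" "fst (snd t)" "snd (snd t)"]) auto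
  qed
  also have "\<dots> = (\<Sum>h\<in>cubic_maps p. (hash_sum \<psi> U h)^3) * ((\<Sum>c\<in>{0..<p}. g c) / p)"
    unfolding cube by (subst sum.swap[of _ _ "cubic_maps p"]) (simp only: sum_distrib_right split_def)
  finally show ?thesis .
qed

text \<open>The value at a single point is uniform: independence is applied to the constant function
  1. The points kept fixed must differ from \<open>x\<close>, and such a residue exists because
  \<open>p > 1\<close>.\<close>

lemma sum_cubic_maps_eval:
  assumes "prime p" "x \<in> {0..<p}"
  shows "(\<Sum>h\<in>cubic_maps p. g (h x)) = card (cubic_maps p) * ((\<Sum>c\<in>{0..<p}. g c) / p)"
proof -
  have "p > 1" using assms(1) by (simp add: prime_gt_1_int)
  then obtain u where "u \<in> {0..<p} - {x}"
    by (metis DiffI atLeastLessThan_iff empty_iff insert_iff less_irrefl order_less_trans zero_le_one zero_less_one order_refl)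
  then show ?thesis
    using sum_cubic_maps_independent[OF assms, of u u u "\<lambda>_. 1" g] by simp
qed

section \<open>Second and fourth moments of centred hash sums\<close>

context
  fixes p :: int and \<psi> :: "int \<Rightarrow> real"
  assumes p: "prime p" and mean_zero: "(\<Sum>c\<in>{0..<p}. \<psi> c) = 0"
begin

text \<open>By induction on \<open>U\<close>: the cross term with a new point factors by
  independence and vanishes because \<psi> has mean zero.\<close>

lemma second_moment:
  assumes "U \<subseteq> {0..<p}"
  shows "(\<Sum>h\<in>cubic_maps p. (hash_sum \<psi> U h)^2) =
    card (cubic_maps p) * (card U * ((\<Sum>c\<in>{0..<p}. (\<psi> c)^2) / p))"
proof -
  have "finite U" using assms finite_subset by blast
  then show ?thesis using assms
  proof (induction U)
    case empty
    then show ?case by (simp add: hash_sum_def)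
  next
    case (insert x U)
    then have x: "x \<in> {0..<p}" "U \<subseteq> {0..<p} - {x}" by auto
    have "(\<Sum>h\<in>cubic_maps p. (hash_sum \<psi> (insert x U) h)^2) =
      (\<Sum>h\<in>cubic_maps p. (hash_sum \<psi> U h)^2) + 2 * (\<Sum>h\<in>cubic_maps p. hash_sum \<psi> U h * \<psi> (h x))
      + (\<Sum>h\<in>cubic_maps p. (\<psi> (h x))^2)"
      using insert.hyps by (simp add: hash_sum_def power2_sum sum.distrib sum_distrib_left algebra_simps)
    also have "\<dots> = (\<Sum>h\<in>cubic_maps p. (hash_sum \<psi> U h)^2) + (\<Sum>h\<in>cubic_maps p. (\<psi> (h x))^2)"
      using sum_hash_sum_mult[OF p x, of \<psi> \<psi>] mean_zero by simp
    also have "(\<Sum>h\<in>cubic_maps p. (\<psi> (h x))^2) = card (cubic_maps p) * ((\<Sum>c\<in>{0..<p}. (\<psi> c)^2) / p)"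
      by (rule sum_cubic_maps_eval[OF p x(1)])
    finally show ?case using insert by (simp add: algebra_simps add_divide_distrib)
  qed
qed

text \<open>By induction on \<open>U\<close>, expanding the fourth power at a new point. The term
  linear in the new value vanishes because \<psi> has mean zero, the cubic one because the old hash
  sum has mean zero.\<close>

lemma fourth_moment:
  fixes \<sigma>2 \<kappa> :: real
  defines "\<sigma>2 \<equiv> (\<Sum>c\<in>{0..<p}. (\<psi> c)^2) / p" and "\<kappa> \<equiv> (\<Sum>c\<in>{0..<p}. (\<psi> c)^4) / p"
  assumes "U \<subseteq> {0..<p}"
  shows "(\<Sum>h\<in>cubic_maps p. (hash_sum \<psi> U h)^4) \<le>
    card (cubic_maps p) * (card U * \<kappa> + 3 * (card U * \<sigma>2)^2)"
proof -
  have "finite U" using assms finite_subset by blast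
  then show ?thesis using assms(3)
  proof (induction U)
    case empty
    then show ?case by (simp add: hash_sum_def)
  next
    case (insert x U)
    let ?S = "\<lambda>f. \<Sum>h\<in>cubic_maps p. f h :: real"
    let ?N = "real (card (cubic_maps p))" and ?a = "real (card U)"
    from insert have x: "x \<in> {0..<p}" "U \<subseteq> {0..<p} - {x}" by auto
    have exp: "(b + a)^4 = a^4 + 4 * (a^3 * b) + 6 * (a^2 * b^2) + 4 * (a * b^3) + b^4" for a b :: real
      by (simp add: eval_nat_numeral algebra_simps)
    have "?S (\<lambda>h. (hash_sum \<psi> (insert x U) h)^4) = ?S (\<lambda>h. (hash_sum \<psi> U h)^4)
      + 4 * ?S (\<lambda>h. (hash_sum \<psi> U h)^3 * \<psi> (h x))
      + 6 * ?S (\<lambda>h. (hash_sum \<psi> U h)^2 * (\<psi> (h x))^2)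
      + 4 * ?S (\<lambda>h. hash_sum \<psi> U h * (\<psi> (h x))^3) + ?S (\<lambda>h. (\<psi> (h x))^4)"
      using insert.hyps by (simp add: hash_sum_def exp sum.distrib sum_distrib_left)
    also have "?S (\<lambda>h. (hash_sum \<psi> U h)^3 * \<psi> (h x)) = 0"
      using sum_hash_sum_power3_mult[OF p x, of \<psi> \<psi>] mean_zero by simp
    also have "?S (\<lambda>h. hash_sum \<psi> U h * (\<psi> (h x))^3) = 0"
    proof -
      have "?S (hash_sum \<psi> U) = (\<Sum>u\<in>U. ?S (\<lambda>h. \<psi> (h u)))"
        unfolding hash_sum_def by (rule sum.swap)
      also have "\<dots> = 0"
        using x mean_zero by (intro sum.neutral) (auto simp: sum_cubic_maps_eval[OF p])
      finally show ?thesis using sum_hash_sum_mult[OF p x, of \<psi> "\<lambda>c. (\<psi> c)^3"] by simp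
    qed
    also have "?S (\<lambda>h. (hash_sum \<psi> U h)^2 * (\<psi> (h x))^2) = ?N * (?a * \<sigma>2) * \<sigma>2"
      using sum_hash_sum_power2_mult[OF p x, of \<psi> "\<lambda>c. (\<psi> c)^2"] second_moment[of U] insert.prems
      by (simp add: \<sigma>2_def)
    also have "?S (\<lambda>h. (\<psi> (h x))^4) = ?N * \<kappa>"
      unfolding \<kappa>_def by (rule sum_cubic_maps_eval[OF p x(1)])
    also have "?S (\<lambda>h. (hash_sum \<psi> U h)^4) \<le> ?N * (?a * \<kappa> + 3 * (?a * \<sigma>2)^2)"
      using insert by auto
    finally have "?S (\<lambda>h. (hash_sum \<psi> (insert x U) h)^4) \<le>
      ?N * (?a * \<kappa> + 3 * (?a * \<sigma>2)^2) + 6 * (?N * (?a * \<sigma>2) * \<sigma>2) + ?N * \<kappa>" by simp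
    \<comment> \<open>The mixed term \<open>6 * (?a * \<sigma>2) * \<sigma>2\<close> is absorbed by
      the growth of \<open>3 * (?a * \<sigma>2)^2\<close> when \<open>?a\<close> becomes
      \<open>?a + 1\<close>, with \<open>3 * \<sigma>2^2\<close> to spare.\<close>
    also have "\<dots> = ?N * ((?a + 1) * \<kappa> + 3 * ((?a + 1) * \<sigma>2)^2) - 3 * ?N * \<sigma>2^2"
      by (simp add: algebra_simps power2_eq_square)
    also have "\<dots> \<le> ?N * ((?a + 1) * \<kappa> + 3 * ((?a + 1) * \<sigma>2)^2)" by simp
    finally show ?case using insert.hyps by (simp add: add.commute)
  qed
qed

end

section \<open>Positive parts of hash sums, at one scale and over all scales\<close>

lemma sum_indicator_subset:
  assumes "finite S" "A \<subseteq> S"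
  shows "(\<Sum>c\<in>S. indicator A c) = real (card A)"
  using assms sum_mult_indicator[of S "\<lambda>_. 1 :: real" A] by (simp add: Int_absorb1)

text \<open>The factor 6 bounds \<open>(1 + t) * (1 + 2 * t)\<close> by 6 for t \<le> 1 and by 6 *
  t^2 for t > 1. Inside, the 1 serves small t, and the fraction is the fourth moment constant over
  the cube of the gap \<open>l - 1\<close>, which serves large t.\<close>

definition positive_part_const :: "real \<Rightarrow> real" where
  "positive_part_const l = 6 * (1 + (4 * l^2 * (1 + l^2) + 3 * (1 + l^2)^2) / (l - 1)^3)"

lemma positive_part_const_nonneg: "l > 1 \<Longrightarrow> positive_part_const l \<ge> 0"
  unfolding positive_part_const_def
  by (intro mult_nonneg_nonneg add_nonneg_nonneg divide_nonneg_nonneg) auto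

text \<open>For t \<le> 1 the positive part is at most the expected number of points of U that hit P. For
  t > 1 the mean of the sum is - (l - 1) * t and the fourth moment about it is of order t ^ 2, so the
  positive part is of order t ^ 2 / t ^ 3. The bound t / ((1 + t) * (1 + 2 * t)) has the order of
  min t (1 / t) and telescopes along t, 2 * t, 4 * t, ...\<close>

lemma sum_positive_part_le:
  fixes l :: real and P Q :: "int set"
  defines "\<phi> \<equiv> \<lambda>c. indicator P c - l * indicator Q c"
  assumes p: "prime p" and l: "l > 1" and PQ: "P \<subseteq> {0..<p}" "Q \<subseteq> {0..<p}" "P \<inter> Q = {}"
    and card: "card P = r" "card Q = r" and U: "U \<subseteq> {0..<p}" and t_def: "t = card U * (r / p)"
  shows "(\<Sum>h\<in>cubic_maps p. max 0 (hash_sum \<phi> U h)) \<le>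
    card (cubic_maps p) * (positive_part_const l * (t / ((1 + t) * (1 + 2 * t))))"
proof -
  have p0: "p > 0" using p by (simp add: prime_gt_0_int)
  have t0: "t \<ge> 0" using p0 by (simp add: t_def)
  let ?N = "real (card (cubic_maps p))"
  define C where "C = 4 * l^2 * (1 + l^2) + 3 * (1 + l^2)^2"
  have C0: "C \<ge> 0" by (simp add: C_def)
  have K: "positive_part_const l = 6 * (1 + C / (l - 1)^3)" by (simp add: positive_part_const_def C_def)
  have Cl: "C / (l - 1)^3 \<ge> 0" using C0 l by simp
  show ?thesis
  proof (cases "t \<le> 1")
    case True
    have "(\<Sum>h\<in>cubic_maps p. max 0 (hash_sum \<phi> U h)) \<le> (\<Sum>h\<in>cubic_maps p. \<Sum>x\<in>U. indicator P (h x))"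
    proof (rule sum_mono)
      fix h
      have "hash_sum \<phi> U h \<le> (\<Sum>x\<in>U. indicator P (h x))"
        unfolding hash_sum_def \<phi>_def using l by (intro sum_mono) auto
      then show "max 0 (hash_sum \<phi> U h) \<le> (\<Sum>x\<in>U. indicator P (h x))"
        by (simp add: sum_nonneg)
    qed
    also have "\<dots> = (\<Sum>x\<in>U. \<Sum>h\<in>cubic_maps p. indicator P (h x))" by (rule sum.swap)
    also have "\<dots> = (\<Sum>x\<in>U. ?N * (r / p))"
    proof (rule sum.cong[OF refl])
      fix x assume "x \<in> U"
      then have "(\<Sum>h\<in>cubic_maps p. indicator P (h x)) = ?N * ((\<Sum>c\<in>{0..<p}. indicator P c) / p)"
        using U by (intro sum_cubic_maps_eval p) auto
      also have "(\<Sum>c\<in>{0..<p}. indicator P c) = real r"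
        using PQ card by (simp add: sum_indicator_subset)
      finally show "(\<Sum>h\<in>cubic_maps p. indicator P (h x)) = ?N * (r / p)" .
    qed
    also have "\<dots> = ?N * t" by (simp add: t_def)
    also have "\<dots> \<le> ?N * (positive_part_const l * (t / ((1 + t) * (1 + 2 * t))))"
    proof (rule mult_left_mono)
      have "(1 + t) * (1 + 2 * t) \<le> 2 * 3" using True t0 by (intro mult_mono) auto
      then have "t * ((1 + t) * (1 + 2 * t)) \<le> t * 6" using t0 by (intro mult_left_mono) auto
      moreover have "0 < (1 + t) * (1 + 2 * t)" using t0 by (intro mult_pos_pos) auto
      ultimately have "t \<le> t * 6 / ((1 + t) * (1 + 2 * t))" by (simp only: pos_le_divide_eq)
      then have "t \<le> 6 * (t / ((1 + t) * (1 + 2 * t)))" by (simp add: mult.commute)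
      also have "\<dots> \<le> positive_part_const l * (t / ((1 + t) * (1 + 2 * t)))"
        using Cl t0 by (intro mult_right_mono) (auto simp: K)
      finally show "t \<le> positive_part_const l * (t / ((1 + t) * (1 + 2 * t)))" .
    qed simp
    finally show ?thesis .
  next
    case False
    define \<mu> where "\<mu> = - (l - 1) * (r / p)"
    define \<psi> where "\<psi> c = \<phi> c - \<mu>" for c
    have sumP: "(\<Sum>c\<in>{0..<p}. indicator P c) = real r" and sumQ: "(\<Sum>c\<in>{0..<p}. indicator Q c) = real r"
      using PQ card by (simp_all add: sum_indicator_subset)
    have sum\<phi>: "(\<Sum>c\<in>{0..<p}. \<phi> c) = p * \<mu>"
      using p0 by (simp add: \<phi>_def \<mu>_def sum_subtractf sumP sumQ left_diff_distrib flip: sum_distrib_left)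
    have mean: "(\<Sum>c\<in>{0..<p}. \<psi> c) = 0"
      using p0 by (simp add: \<psi>_def sum_subtractf sum\<phi>)
    have sq: "(\<Sum>c\<in>{0..<p}. (\<phi> c)^2) = (1 + l^2) * r"
    proof -
      have "(\<phi> c)^2 = indicator P c + l^2 * indicator Q c" for c
        using PQ(3) by (auto simp: \<phi>_def indicator_def)
      then show ?thesis by (simp add: sum.distrib sumP sumQ distrib_right flip: sum_distrib_left)
    qed
    define \<sigma>2 where "\<sigma>2 = (\<Sum>c\<in>{0..<p}. (\<psi> c)^2) / p"
    define \<kappa> where "\<kappa> = (\<Sum>c\<in>{0..<p}. (\<psi> c)^4) / p"
    have "(\<Sum>c\<in>{0..<p}. (\<psi> c)^2) = (\<Sum>c\<in>{0..<p}. (\<phi> c)^2) - 2 * \<mu> * (\<Sum>c\<in>{0..<p}. \<phi> c) + p * \<mu>^2"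
      using p0 by (simp add: \<psi>_def power2_diff sum.distrib sum_subtractf sum_distrib_left algebra_simps)
    also have "\<dots> \<le> (1 + l^2) * r"
      using p0 mult_nonneg_nonneg[of "real_of_int p" "\<mu>^2"] unfolding sq sum\<phi>
      by (simp add: power2_eq_square mult_ac)
    finally have \<sigma>2: "\<sigma>2 \<le> (1 + l^2) * (r / p)"
      using p0 by (simp add: \<sigma>2_def divide_right_mono)
    have \<sigma>20: "\<sigma>2 \<ge> 0" using p0 by (simp add: \<sigma>2_def sum_nonneg)
    \<comment> \<open>The values of \<phi> are 1, 0 and \<open>- l\<close>, and
      \<open>- \<mu>\<close> lies between 0 and \<open>l - 1\<close>; so \<psi> is at most
      \<open>2 * l\<close> in absolute value, and its fourth power is at most \<open>4 * l^2\<close>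
      times its square.\<close>
    have \<kappa>: "\<kappa> \<le> 4 * l^2 * \<sigma>2"
    proof -
      have "card P \<le> card {0..<p}" using PQ by (intro card_mono) auto
      then have "r / p \<le> 1" using p0 card by simp
      then have "(l - 1) * (r / p) \<le> (l - 1) * 1" using l by (intro mult_left_mono) auto
      then have \<mu>1: "- \<mu> \<le> l - 1" by (simp only: \<mu>_def mult_minus_left minus_minus mult_1_right)
      have "0 \<le> (l - 1) * (r / p)" using l p0 by simp
      then have \<mu>0: "0 \<le> - \<mu>" by (simp only: \<mu>_def mult_minus_left minus_minus)
      have "(\<psi> c)^4 \<le> 4 * l^2 * (\<psi> c)^2" for c
      proof -
        have "\<bar>\<psi> c\<bar> \<le> 2 * l" using \<mu>0 \<mu>1 l by (auto simp: \<psi>_def \<phi>_def indicator_def)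
        then have "(\<psi> c)^2 \<le> (2 * l)^2" using power_mono[of "\<bar>\<psi> c\<bar>" "2 * l" 2] by simp
        then have "(\<psi> c)^2 * (\<psi> c)^2 \<le> (2 * l)^2 * (\<psi> c)^2" by (rule mult_right_mono) simp
        then show ?thesis by (simp add: power2_eq_square power4_eq_xxxx mult_ac)
      qed
      then have "(\<Sum>c\<in>{0..<p}. (\<psi> c)^4) \<le> (\<Sum>c\<in>{0..<p}. 4 * l^2 * (\<psi> c)^2)" by (intro sum_mono)
      then show ?thesis using p0
        by (simp add: \<kappa>_def \<sigma>2_def divide_right_mono flip: sum_distrib_left)
    qed
    \<comment> \<open>The hash sum of \<phi> over \<open>U\<close> has mean \<open>- d\<close>, so
      that of \<psi> is its centred version.\<close>
    define d where "d = (l - 1) * t"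
    have t1: "t > 1" and d0: "d > 0" using False l by (auto simp: d_def)
    have "d = - (card U * \<mu>)"
      by (simp only: d_def \<mu>_def t_def mult_minus_left mult_minus_right minus_minus mult_ac)
    then have shift: "hash_sum \<psi> U h = hash_sum \<phi> U h + d" for h
      by (simp add: hash_sum_def \<psi>_def sum_subtractf)
    \<comment> \<open>A Markov type bound: if the hash sum y of \<phi> is nonnegative, the centred
      sum is y + d, and y * d^3 \<le> (y + d)^4.\<close>
    have "(\<Sum>h\<in>cubic_maps p. max 0 (hash_sum \<phi> U h)) * d^3 \<le> (\<Sum>h\<in>cubic_maps p. (hash_sum \<psi> U h)^4)"
      unfolding sum_distrib_right
    proof (rule sum_mono)
      fix h
      show "max 0 (hash_sum \<phi> U h) * d^3 \<le> (hash_sum \<psi> U h)^4"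
      proof (cases "hash_sum \<phi> U h \<ge> 0")
        case True
        then have "max 0 (hash_sum \<phi> U h) * d^3 \<le> (hash_sum \<phi> U h + d) * (hash_sum \<phi> U h + d)^3"
          using d0 by (intro mult_mono power_mono) auto
        then show ?thesis by (simp add: shift power4_eq_xxxx power3_eq_cube)
      qed simp
    qed
    also have "\<dots> \<le> ?N * (card U * \<kappa> + 3 * (card U * \<sigma>2)^2)"
      unfolding \<sigma>2_def \<kappa>_def by (rule fourth_moment[OF p mean U])
    also have "\<dots> \<le> ?N * (C * t^2)"
    proof (rule mult_left_mono)
      have a\<sigma>: "card U * \<sigma>2 \<le> (1 + l^2) * t"
        using mult_left_mono[OF \<sigma>2, of "card U"] by (simp add: t_def mult_ac)
      have "card U * \<kappa> \<le> 4 * l^2 * (card U * \<sigma>2)"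
        using mult_left_mono[OF \<kappa>, of "card U"] by (simp add: mult_ac)
      also have "\<dots> \<le> 4 * l^2 * ((1 + l^2) * t)" using a\<sigma> by (rule mult_left_mono) simp
      also have "\<dots> \<le> 4 * l^2 * ((1 + l^2) * t^2)"
        using t1 by (intro mult_left_mono) (auto simp: power2_eq_square)
      finally have "card U * \<kappa> \<le> 4 * l^2 * (1 + l^2) * t^2" by (simp add: mult_ac)
      moreover have "(card U * \<sigma>2)^2 \<le> ((1 + l^2) * t)^2"
        using a\<sigma> \<sigma>20 by (intro power_mono) auto
      moreover have "C * t^2 = 4 * l^2 * (1 + l^2) * t^2 + 3 * ((1 + l^2) * t)^2"
        unfolding C_def power_mult_distrib[of "1 + l^2" t] by (simp only: distrib_right mult.assoc)
      ultimately show "card U * \<kappa> + 3 * (card U * \<sigma>2)^2 \<le> C * t^2"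
        by linarith
    qed simp
    finally have "(\<Sum>h\<in>cubic_maps p. max 0 (hash_sum \<phi> U h)) \<le> ?N * (C * t^2) / d^3"
      using d0 by (simp add: pos_le_divide_eq)
    also have "\<dots> = ?N * (C / (l - 1)^3 * (1 / t))"
      using t1 by (simp add: d_def power_mult_distrib power2_eq_square power3_eq_cube)
    also have "\<dots> \<le> ?N * (positive_part_const l * (t / ((1 + t) * (1 + 2 * t))))"
    proof (rule mult_left_mono)
      have "(1 + t) * (1 + 2 * t) \<le> (2 * t) * (3 * t)" using t1 by (intro mult_mono) auto
      then have "1 / t \<le> 6 * (t / ((1 + t) * (1 + 2 * t)))" using t1 by (simp add: divide_simps)
      then have "C / (l - 1)^3 * (1 / t) \<le> C / (l - 1)^3 * (6 * (t / ((1 + t) * (1 + 2 * t))))"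
        using Cl by (rule mult_left_mono)
      also have "\<dots> \<le> positive_part_const l * (t / ((1 + t) * (1 + 2 * t)))"
        unfolding K using t0 by (simp add: algebra_simps)
      finally show "C / (l - 1)^3 * (1 / t) \<le> positive_part_const l * (t / ((1 + t) * (1 + 2 * t)))" .
    qed simp
    finally show ?thesis .
  qed
qed

text \<open>With F t = t / (1 + t), the summand at t is F (2 * t) - F t, so the sum telescopes, and
  F stays below 1.\<close>

lemma sum_dyadic_le:
  fixes s :: real
  assumes "s \<ge> 0"
  shows "(\<Sum>i<j. s * 2^i / ((1 + s * 2^i) * (1 + 2 * (s * 2^i)))) \<le> 1"
proof -
  define F where "F t = t / (1 + t)" for t :: real
  have "(\<Sum>i<j. s * 2^i / ((1 + s * 2^i) * (1 + 2 * (s * 2^i)))) = (\<Sum>i<j. F (s * 2^(Suc i)) - F (s * 2^i))"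
  proof (rule sum.cong[OF refl])
    fix i
    define t where "t = s * 2^i"
    have "t \<ge> 0" using assms by (simp add: t_def)
    then have "t / ((1 + t) * (1 + 2 * t)) = F (2 * t) - F t"
      by (simp add: F_def divide_simps) (simp add: algebra_simps)
    moreover have "2 * t = s * 2^(Suc i)" by (simp add: t_def)
    ultimately show "s * 2^i / ((1 + s * 2^i) * (1 + 2 * (s * 2^i))) = F (s * 2^(Suc i)) - F (s * 2^i)"
      by (simp only: t_def)
  qed
  also have "\<dots> = F (s * 2^j) - F s" using sum_lessThan_telescope[of "\<lambda>i. F (s * 2^i)"] by simp
  also have "\<dots> \<le> F (s * 2^j)" using assms by (simp add: F_def)
  also have "\<dots> \<le> 1" using assms by (simp add: F_def divide_le_eq_1 add_pos_nonneg)
  finally show ?thesis .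
qed

text \<open>The parameter t doubles from one scale to the next, so the bounds telescope. That the
  result does not depend on the number \<open>j\<close> of scales is the source of the saving by
  \<open>j\<close>.\<close>

lemma sum_scales_positive_part_le:
  fixes l :: real and P Q :: "nat \<Rightarrow> int set"
  assumes p: "prime p" and l: "l > 1" and U: "U \<subseteq> {0..<p}"
    and PQ: "\<And>i. i < j \<Longrightarrow> P i \<subseteq> {0..<p} \<and> Q i \<subseteq> {0..<p} \<and> P i \<inter> Q i = {} \<and>
      card (P i) = 2^i \<and> card (Q i) = 2^i"
  shows "(\<Sum>h\<in>cubic_maps p. \<Sum>i<j. max 0 (hash_sum (\<lambda>c. indicator (P i) c - l * indicator (Q i) c) U h)) \<le>
    card (cubic_maps p) * positive_part_const l"
proof -
  let ?N = "real (card (cubic_maps p))"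
  define s where "s = card U / p"
  have s0: "s \<ge> 0" using p by (simp add: s_def prime_ge_0_int)
  have K0: "positive_part_const l \<ge> 0" using l by (rule positive_part_const_nonneg)
  have "(\<Sum>h\<in>cubic_maps p. \<Sum>i<j. max 0 (hash_sum (\<lambda>c. indicator (P i) c - l * indicator (Q i) c) U h)) =
    (\<Sum>i<j. \<Sum>h\<in>cubic_maps p. max 0 (hash_sum (\<lambda>c. indicator (P i) c - l * indicator (Q i) c) U h))"
    by (rule sum.swap)
  also have "\<dots> \<le> (\<Sum>i<j. ?N * (positive_part_const l * (s * 2^i / ((1 + s * 2^i) * (1 + 2 * (s * 2^i))))))"
    using PQ by (intro sum_mono sum_positive_part_le[OF p l _ _ _ _ _ U]) (auto simp: s_def)
  also have "\<dots> = ?N * (positive_part_const l * (\<Sum>i<j. s * 2^i / ((1 + s * 2^i) * (1 + 2 * (s * 2^i)))))"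
    by (simp only: sum_distrib_left)
  also have "\<dots> \<le> ?N * (positive_part_const l * 1)"
    using sum_dyadic_le[OF s0, of j] K0 by (intro mult_left_mono) auto
  finally show ?thesis by simp
qed

text \<open>Chebyshev's inequality. The number of residues sent into \<open>R\<close> has mean
  \<open>card R\<close> and variance at most \<open>card R\<close>, so at most a fraction 1 /
  \<open>card R\<close> of the maps, hence at most half, miss \<open>R\<close>. Discarding pairs
  without neighbours therefore costs only a factor 2.\<close>

lemma half_cubic_maps_hit:
  assumes p: "prime p" and R: "R \<subseteq> {0..<p}" "card R \<ge> 2"
  shows "card (cubic_maps p) \<le> 2 * card {h \<in> cubic_maps p. \<exists>x\<in>{0..<p}. h x \<in> R}"
proof -
  have p0: "p > 0" using p by (simp add: prime_gt_0_int)
  let ?H = "cubic_maps p"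
  define miss where "miss = {h \<in> ?H. \<forall>x\<in>{0..<p}. h x \<notin> R}"
  define \<rho> where "\<rho> = card R / p"
  define \<psi> where "\<psi> c = indicator R c - \<rho>" for c
  have sumR: "(\<Sum>c\<in>{0..<p}. indicator R c) = real (card R)"
    using R by (simp add: sum_indicator_subset)
  have mean: "(\<Sum>c\<in>{0..<p}. \<psi> c) = 0"
    using p0 by (simp add: \<psi>_def sum_subtractf sumR \<rho>_def)
  have "(\<Sum>c\<in>{0..<p}. (\<psi> c)^2) = (\<Sum>c\<in>{0..<p}. indicator R c - 2 * \<rho> * indicator R c + \<rho>^2)"
    by (intro sum.cong refl) (simp add: \<psi>_def indicator_def power2_eq_square algebra_simps)
  also have "\<dots> = card R - 2 * \<rho> * card R + p * \<rho>^2"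
    using p0 by (simp add: sum.distrib sum_subtractf sumR flip: sum_distrib_left)
  also have "\<dots> \<le> card R"
    using p0 by (simp add: \<rho>_def power2_eq_square)
  finally have var: "(\<Sum>c\<in>{0..<p}. (\<psi> c)^2) \<le> card R" .
  have fin: "finite ?H" using p0 by (rule finite_cubic_maps)
  have "card miss * real (card R)^2 = (\<Sum>h\<in>miss. (hash_sum \<psi> {0..<p} h)^2)"
  proof -
    have "hash_sum \<psi> {0..<p} h = - real (card R)" if "h \<in> miss" for h
      using that p0 by (simp add: miss_def hash_sum_def \<psi>_def \<rho>_def sum_subtractf)
    then show ?thesis by simp
  qed
  also have "\<dots> \<le> (\<Sum>h\<in>?H. (hash_sum \<psi> {0..<p} h)^2)"
    using fin by (intro sum_mono2) (auto simp: miss_def)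
  also have "\<dots> = card ?H * (\<Sum>c\<in>{0..<p}. (\<psi> c)^2)"
    using second_moment[OF p mean, of "{0..<p}"] p0 by simp
  also have "\<dots> \<le> card ?H * real (card R)" using var by (rule mult_left_mono) simp
  finally have "card miss * real (card R) \<le> card ?H" using R(2) by (simp add: power2_eq_square)
  moreover have "card miss * 2 \<le> card miss * card R" using R(2) by (rule mult_left_mono) simp
  then have "card miss * 2 \<le> card miss * real (card R)" by (metis of_nat_le_iff of_nat_mult)
  ultimately have "2 * card miss \<le> card ?H" by linarith
  moreover have "card ?H = card miss + card {h \<in> ?H. \<exists>x\<in>{0..<p}. h x \<in> R}"
    using fin by (subst card_Un_disjoint[symmetric]) (auto simp: miss_def intro: arg_cong[of _ _ card])
  ultimately show ?thesis by simp
qed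

section \<open>Bipartite orientations\<close>

text \<open>Meant for neighbourhoods inside \<open>{0..<m}\<close>, as the context below assumes;
  then \<open>{0..<m}\<close> and \<open>{m..<n}\<close> are the two sides.\<close>

definition bipartite_orientation ::
    "nat \<Rightarrow> nat \<Rightarrow> (nat \<Rightarrow> nat set) \<Rightarrow> (nat \<Rightarrow> nat set) \<Rightarrow> nat pair_pre_digraph" where
  "bipartite_orientation m n Out In = \<lparr> pverts = {0..<n},
     parcs = (SIGMA v:{m..<n}. Out v) \<union> (SIGMA v:{m..<n}. In v)\<inverse> \<rparr>"

lemma (in pair_fin_digraph) bias_le:
  assumes "\<And>A B. A \<subseteq> pverts G \<Longrightarrow> B \<subseteq> pverts G \<Longrightarrow>
    real (arcs_from_to G B A) \<le> \<eta> * real (arcs_from_to G A B) \<Longrightarrow> real (arcs_from_to G A B) \<le> W"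
  shows "real (bias \<eta> G) \<le> W"
proof -
  have "bias \<eta> G \<in> bias_values \<eta> G"
    unfolding bias_def by (intro Max_in finite_bias_values bias_values_nonempty)
  then show ?thesis using assms by (auto simp: bias_values_def)
qed

context
  fixes m n :: nat and Out In :: "nat \<Rightarrow> nat set" and D :: "nat pair_pre_digraph"
  assumes m: "m \<le> n" and sub: "\<And>v. Out v \<subseteq> {0..<m}" "\<And>v. In v \<subseteq> {0..<m}"
    and disj: "\<And>v. Out v \<inter> In v = {}"
  defines "D \<equiv> bipartite_orientation m n Out In"
begin

lemma Out_less: "x \<in> Out v \<Longrightarrow> x < m" and In_less: "x \<in> In v \<Longrightarrow> x < m"
  using sub[of v] by auto

lemma oriented_graph_bipartite_orientation: "oriented_graph D"
proof
  have D: "pverts D = {0..<n}" "parcs D = (SIGMA v:{m..<n}. Out v) \<union> (SIGMA v:{m..<n}. In v)\<inverse>"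
    by (simp_all add: D_def bipartite_orientation_def)
  show v1: "fst e \<in> pverts D" if "e \<in> parcs D" for e
    using that m by (auto simp: D dest!: Out_less In_less)
  show v2: "snd e \<in> pverts D" if "e \<in> parcs D" for e
    using that m by (auto simp: D dest!: Out_less In_less)
  show fin: "finite (pverts D)" by (simp add: D)
  have "parcs D \<subseteq> pverts D \<times> pverts D" using v1 v2 by (auto simp: mem_Times_iff)
  then show "finite (parcs D)" using fin finite_subset by blast
  show "fst e \<noteq> snd e" if "e \<in> parcs D" for e
    using that by (auto simp: D dest!: Out_less In_less)
  show "(y, x) \<notin> parcs D" if "x \<noteq> y" "(x, y) \<in> parcs D" for x y
  proof -
    have "a \<notin> In v" if "a \<in> Out v" for a v using disj[of v] that by blast
    then show ?thesis using that by (auto simp: D dest: Out_less In_less)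
  qed
qed

lemma no_isolated_bipartite_orientation:
  assumes "\<And>v. m \<le> v \<Longrightarrow> v < n \<Longrightarrow> \<exists>x. x \<in> Out v \<union> In v"
    and "\<And>x. x < m \<Longrightarrow> \<exists>v\<in>{m..<n}. x \<in> Out v \<union> In v"
  shows "\<forall>x\<in>pverts D. \<not> isolated D x"
proof
  fix x assume "x \<in> pverts D"
  then have "x < n" by (simp add: D_def bipartite_orientation_def)
  have "\<exists>y. (x, y) \<in> parcs D \<or> (y, x) \<in> parcs D"
  proof (cases "x < m")
    case True
    from assms(2)[OF this] obtain v where "v \<in> {m..<n}" "x \<in> Out v \<union> In v" by blast
    then have "(v, x) \<in> parcs D \<or> (x, v) \<in> parcs D"
      by (auto simp: D_def bipartite_orientation_def)
    then show ?thesis by blast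
  next
    case False
    with assms(1)[of x] \<open>x < n\<close> obtain y where "y \<in> Out x \<union> In x" by auto
    with False \<open>x < n\<close> have "(x, y) \<in> parcs D \<or> (y, x) \<in> parcs D"
      by (auto simp: D_def bipartite_orientation_def)
    then show ?thesis by blast
  qed
  then show "\<not> isolated D x" by (force simp: isolated_def)
qed

text \<open>Each arc has exactly one end in \<open>{m..<n}\<close>. Arcs are grouped by that end,
  which is the tail in the first sum and the head in the second.\<close>

lemma arcs_from_to_bipartite_orientation:
  "arcs_from_to D A B =
    (\<Sum>v\<in>{m..<n} \<inter> A. card (Out v \<inter> B)) + (\<Sum>v\<in>{m..<n} \<inter> B. card (In v \<inter> A))"
proof -
  have fin: "finite (Out v)" "finite (In v)" for v
    using finite_subset[OF sub(1)] finite_subset[OF sub(2)] by simp_all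
  let ?R = "SIGMA v:{m..<n} \<inter> A. Out v \<inter> B" and ?S = "SIGMA v:{m..<n} \<inter> B. In v \<inter> A"
  have "{(x, y) \<in> parcs D. x \<in> A \<and> y \<in> B} = ?R \<union> ?S\<inverse>"
    by (auto simp: D_def bipartite_orientation_def)
  moreover have "?R \<inter> ?S\<inverse> = {}"
    by (auto dest!: Out_less In_less)
  moreover have "finite ?R" "finite ?S" using fin by (intro finite_SigmaI; simp)+
  ultimately have "arcs_from_to D A B = card ?R + card ?S"
    by (simp only: arcs_from_to_def card_Un_disjoint finite_converse card_inverse)
  also have "card ?R = (\<Sum>v\<in>{m..<n} \<inter> A. card (Out v \<inter> B))" using fin by (intro card_SigmaI) auto
  also have "card ?S = (\<Sum>v\<in>{m..<n} \<inter> B. card (In v \<inter> A))" using fin by (intro card_SigmaI) auto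
  finally show ?thesis .
qed

text \<open>For a pair \<open>A\<close>, \<open>B\<close> admissible in the bias, e(A,B) - l *
  e(B,A) is at least (1 - l * \<eta>) * e(A,B). It also splits into contributions of the vertices
  from \<open>m\<close> on: those in \<open>A\<close> look at \<open>B\<close>, those in
  \<open>B\<close> look at \<open>A\<close>, and each group contributes at most
  \<open>W\<close>.\<close>

lemma bias_bipartite_orientation_le:
  fixes W l \<eta> :: real
  assumes l: "0 < l" "l * \<eta> < 1"
    and Out: "\<And>U. U \<subseteq> {0..<m} \<Longrightarrow>
      (\<Sum>v\<in>{m..<n}. max 0 (real (card (Out v \<inter> U)) - l * real (card (In v \<inter> U)))) \<le> W"
    and In: "\<And>U. U \<subseteq> {0..<m} \<Longrightarrow>
      (\<Sum>v\<in>{m..<n}. max 0 (real (card (In v \<inter> U)) - l * real (card (Out v \<inter> U)))) \<le> W"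
  shows "real (bias \<eta> D) \<le> 2 * W / (1 - l * \<eta>)"
proof -
  interpret oriented_graph D by (rule oriented_graph_bipartite_orientation)
  have restrict: "Out v \<inter> (A \<inter> {0..<m}) = Out v \<inter> A" "In v \<inter> (A \<inter> {0..<m}) = In v \<inter> A" for v A
    using sub by auto
  \<comment> \<open>Positive parts remove the dependence on which vertices from \<open>m\<close> on
    belong to the set; only its part below \<open>m\<close> still matters.\<close>
  have pos: "sum f ({m..<n} \<inter> A) \<le> (\<Sum>v\<in>{m..<n}. max 0 (f v))" for f :: "nat \<Rightarrow> real" and A
  proof -
    have "sum f ({m..<n} \<inter> A) \<le> (\<Sum>v\<in>{m..<n} \<inter> A. max 0 (f v))" by (rule sum_mono) simp
    also have "\<dots> \<le> (\<Sum>v\<in>{m..<n}. max 0 (f v))" by (rule sum_mono2) auto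
    finally show ?thesis .
  qed
  show ?thesis
  proof (rule bias_le)
    fix A B
    assume le: "real (arcs_from_to D B A) \<le> \<eta> * real (arcs_from_to D A B)"
    have "real (arcs_from_to D A B) - l * real (arcs_from_to D B A) =
      (\<Sum>v\<in>{m..<n} \<inter> A. real (card (Out v \<inter> B)) - l * real (card (In v \<inter> B))) +
      (\<Sum>v\<in>{m..<n} \<inter> B. real (card (In v \<inter> A)) - l * real (card (Out v \<inter> A)))"
      by (simp add: arcs_from_to_bipartite_orientation sum_subtractf sum_distrib_left distrib_left)
    also have "\<dots> \<le> (\<Sum>v\<in>{m..<n}. max 0 (real (card (Out v \<inter> B)) - l * real (card (In v \<inter> B)))) +
      (\<Sum>v\<in>{m..<n}. max 0 (real (card (In v \<inter> A)) - l * real (card (Out v \<inter> A))))"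
      by (intro add_mono pos)
    also have "\<dots> \<le> W + W"
      using Out[of "B \<inter> {0..<m}"] In[of "A \<inter> {0..<m}"] by (intro add_mono) (auto simp: restrict)
    finally have "real (arcs_from_to D A B) - l * real (arcs_from_to D B A) \<le> 2 * W" by simp
    moreover have "l * real (arcs_from_to D B A) \<le> l * (\<eta> * real (arcs_from_to D A B))"
      using l le by (intro mult_left_mono) auto
    ultimately have "real (arcs_from_to D A B) * (1 - l * \<eta>) \<le> 2 * W" by (simp add: algebra_simps)
    then show "real (arcs_from_to D A B) \<le> 2 * W / (1 - l * \<eta>)"
      using l by (simp add: pos_le_divide_eq)
  qed
qed

end

section \<open>The construction\<close>

text \<open>Among \<open>N\<close> consecutive indices each residue modulo \<open>M\<close> occurs
  at most \<open>N div M + 1\<close> times. This bounds the cost of the cyclic blow-up.\<close>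

lemma sum_mod_le:
  fixes g :: "nat \<Rightarrow> real"
  assumes "M > 0" and g: "\<And>i. g i \<ge> 0"
  shows "(\<Sum>u<N. g (u mod M)) \<le> real (N div M + 1) * (\<Sum>i<M. g i)"
proof -
  have "N < (N div M + 1) * M" using dividend_less_div_times[OF assms(1), of N] by (simp add: algebra_simps)
  then have "(\<Sum>u<N. g (u mod M)) \<le> (\<Sum>u<(N div M + 1) * M. g (u mod M))"
    using g by (intro sum_mono2) auto
  also have "\<dots> = (\<Sum>q<N div M + 1. \<Sum>u\<in>{q * M..<q * M + M}. g (u mod M))"
    by (rule sum.nat_group[symmetric])
  also have "\<dots> = (\<Sum>q<N div M + 1. \<Sum>i<M. g i)"
  proof (rule sum.cong[OF refl])
    fix q
    have "(\<Sum>u\<in>{q * M..<q * M + M}. g (u mod M)) = (\<Sum>i\<in>{0..<M}. g ((i + q * M) mod M))"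
      using sum.shift_bounds_nat_ivl[of "\<lambda>u. g (u mod M)" 0 "q * M" M] by (simp add: add.commute)
    then show "(\<Sum>u\<in>{q * M..<q * M + M}. g (u mod M)) = (\<Sum>i<M. g i)"
      by (simp add: lessThan_atLeast0)
  qed
  finally show ?thesis by simp
qed

lemma hash_sum_eq_card:
  assumes "finite U"
  shows "hash_sum (\<lambda>c. indicator P c - l * indicator Q c) (int ` U) h =
    real (card {x \<in> U. h (int x) \<in> P}) - l * real (card {x \<in> U. h (int x) \<in> Q})"
proof -
  have ind: "(\<Sum>x\<in>U. indicator R (h (int x))) = real (card {x \<in> U. h (int x) \<in> R})" for R
    using assms by (simp add: indicator_def sum.If_cases Int_def)
  show ?thesis
    by (simp add: hash_sum_def sum.reindex sum_subtractf ind flip: sum_distrib_left)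
qed

text \<open>The vertices below p are the hashed points. Every other vertex v carries a pair \<tau> v = (h, i),
  and the pairs that occur are those which give v at least one neighbour.\<close>

lemma exists_small_bias:
  fixes p j n :: nat and l \<eta> :: real
  assumes p: "prime p" "2 ^ j \<le> p" and j: "j > 0" and n: "p + p ^ 4 * j \<le> n"
    and l: "l > 1" "l * \<eta> < 1"
  shows "\<exists>D :: nat pair_pre_digraph. oriented_graph D \<and> card (pverts D) = n \<and>
      (\<forall>v \<in> pverts D. \<not> isolated D v) \<and>
      real (bias \<eta> D) \<le> 8 * positive_part_const l / (1 - l * \<eta>) * (n / j)"
proof -
  define H where "H = cubic_maps (int p)"
  have ip: "prime (int p)" "int p > 0" using p by (auto simp: prime_gt_0_nat)
  have finH: "finite H" unfolding H_def using ip(2) by (rule finite_cubic_maps)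
  have H_pos: "card H > 0" unfolding H_def using ip(2) by (rule card_cubic_maps_pos)
  have H_le: "card H \<le> p ^ 4" using card_cubic_maps_le[OF ip(2)] by (simp add: H_def)
  \<comment> \<open>Adjacent intervals of length \<open>2 ^ i\<close>; their union ends before
    \<open>2 ^ Suc i\<close>, which is at most \<open>p\<close> for every scale
    \<open>i < j\<close>.\<close>
  define P Q :: "nat \<Rightarrow> int set" where "P i = {0..<2 ^ i}" and "Q i = {2 ^ i..<2 ^ Suc i}" for i
  have PQ: "P i \<union> Q i = {0..<2 ^ Suc i}" "P i \<inter> Q i = {}" "card (P i) = 2 ^ i" "card (Q i) = 2 ^ i" for i
    by (auto simp: P_def Q_def nat_power_eq)
  have PQp: "P i \<union> Q i \<subseteq> {0..<int p}" if "i < j" for i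
  proof -
    have "(2::int) ^ Suc i \<le> 2 ^ j" using that by (intro power_increasing) auto
    also have "\<dots> \<le> int p" using p(2) by (metis of_nat_le_iff of_nat_numeral of_nat_power)
    finally show ?thesis unfolding PQ by auto
  qed
  have PQ_sub: "P i \<subseteq> {0..<int p}" "Q i \<subseteq> {0..<int p}" if "i < j" for i
    using PQp[OF that] by simp_all

  define T where "T = {(h, i) \<in> H \<times> {..<j}. \<exists>x\<in>{0..<int p}. h x \<in> P i \<union> Q i}"
  define M where "M = card T"
  have T_sub: "T \<subseteq> H \<times> {..<j}" by (auto simp: T_def)
  have finT: "finite T" using finH T_sub finite_subset by blast
  \<comment> \<open>The zero map sends every residue into \<open>P 0\<close>. It makes
    \<open>T\<close> nonempty and later supplies a neighbour for every vertex below
    \<open>p\<close>.\<close>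
  have zero_T: "(\<lambda>_. 0, 0) \<in> T"
    using const_in_cubic_maps[of 0 "int p"] j ip(2) by (auto simp: T_def H_def P_def)
  have M_pos: "M > 0" unfolding M_def using finT zero_T card_gt_0_iff by blast
  have M_le: "M \<le> p ^ 4 * j"
  proof -
    have "M \<le> card H * j"
      using card_mono[OF _ T_sub] finH by (simp add: M_def card_cartesian_product)
    also have "\<dots> \<le> p ^ 4 * j" using H_le by simp
    finally show ?thesis .
  qed
  \<comment> \<open>At each scale at least half of the maps hit the union of the two intervals,
    which has at least two elements.\<close>
  have M_ge: "card H * j \<le> 2 * M"
  proof -
    have "T = (SIGMA i:{..<j}. {h \<in> H. \<exists>x\<in>{0..<int p}. h x \<in> P i \<union> Q i})\<inverse>"
      by (auto simp: T_def)
    then have "M = card (SIGMA i:{..<j}. {h \<in> H. \<exists>x\<in>{0..<int p}. h x \<in> P i \<union> Q i})"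
      by (simp only: M_def card_inverse)
    also have "\<dots> = (\<Sum>i<j. card {h \<in> H. \<exists>x\<in>{0..<int p}. h x \<in> P i \<union> Q i})"
      using finH by (intro card_SigmaI) auto
    finally have "M = (\<Sum>i<j. card {h \<in> H. \<exists>x\<in>{0..<int p}. h x \<in> P i \<union> Q i})" .
    moreover have "card H \<le> 2 * card {h \<in> H. \<exists>x\<in>{0..<int p}. h x \<in> P i \<union> Q i}" if "i < j" for i
      unfolding H_def using PQp[OF that]
      by (intro half_cubic_maps_hit ip(1)) (auto simp: PQ nat_mult_distrib nat_power_eq)
    then have "(\<Sum>i<j. card H) \<le> (\<Sum>i<j. 2 * card {h \<in> H. \<exists>x\<in>{0..<int p}. h x \<in> P i \<union> Q i})"
      by (intro sum_mono) auto
    ultimately show ?thesis by (simp add: mult.commute flip: sum_distrib_left)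
  qed

  obtain e where e: "bij_betw e {0..<M} T"
    using ex_bij_betw_nat_finite[OF finT] unfolding M_def by blast
  \<comment> \<open>The blow-up: the vertices from \<open>p\<close> on run through the pairs in
    \<open>T\<close> cyclically, so the copies of each pair are nearly equal in number.\<close>
  define \<tau> where "\<tau> v = e ((v - p) mod M)" for v
  have \<tau>: "\<tau> v \<in> T" for v using e M_pos unfolding \<tau>_def by (auto dest: bij_betwE)
  define pull where "pull R v = {x \<in> {0..<p}. fst (\<tau> v) (int x) \<in> R (snd (\<tau> v))}" for R :: "nat \<Rightarrow> int set" and v
  define D where "D = bipartite_orientation p n (pull P) (pull Q)"
  have pn: "p \<le> n" using n by simp
  have pull_sub: "pull R v \<subseteq> {0..<p}" for R v by (auto simp: pull_def)
  have pull_disj: "pull P v \<inter> pull Q v = {}" for v using PQ(2) by (auto simp: pull_def)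

  have "oriented_graph D"
    unfolding D_def by (rule oriented_graph_bipartite_orientation[OF pn pull_sub pull_sub pull_disj])
  moreover have "card (pverts D) = n" by (simp add: D_def bipartite_orientation_def)
  moreover have "\<forall>v \<in> pverts D. \<not> isolated D v"
    unfolding D_def
  proof (rule no_isolated_bipartite_orientation[OF pn pull_sub pull_sub pull_disj])
    fix v
    obtain h i where hi: "\<tau> v = (h, i)" by fastforce
    with \<tau>[of v] obtain x where "x \<in> {0..<int p}" "h x \<in> P i \<union> Q i" by (auto simp: T_def)
    then have "nat x \<in> pull P v \<union> pull Q v" by (auto simp: pull_def hi)
    then show "\<exists>x. x \<in> pull P v \<union> pull Q v" by blast
  next
    \<comment> \<open>As \<open>M\<close> is at most \<open>p ^ 4 * j\<close> and thus at most
      \<open>n - p\<close>, every pair in \<open>T\<close> is used at least once, in particular the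
      zero map at scale 0.\<close>
    fix x assume x: "x < p"
    have "(\<lambda>_. 0, 0) \<in> e ` {0..<M}" using zero_T bij_betw_imp_surj_on[OF e] by simp
    then obtain k where k: "k \<in> {0..<M}" "(\<lambda>_. 0, 0) = e k" by (rule imageE)
    have "p + k \<in> {p..<n}" using k(1) M_le n by auto
    moreover have "x \<in> pull P (p + k)" using x k(1) k(2)[symmetric] by (simp add: pull_def \<tau>_def P_def)
    ultimately show "\<exists>v\<in>{p..<n}. x \<in> pull P v \<union> pull Q v" by blast
  qed
  moreover have "real (bias \<eta> D) \<le> 8 * positive_part_const l / (1 - l * \<eta>) * (n / j)"
  proof -
    define k where "k = (n - p) div M + 1"
    have K0: "positive_part_const l \<ge> 0" using l(1) by (rule positive_part_const_nonneg)
    have bound: "(\<Sum>v\<in>{p..<n}. max 0 (real (card (pull R v \<inter> U)) - l * real (card (pull S v \<inter> U))))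
        \<le> real k * (real (card H) * positive_part_const l)"
      if U: "U \<subseteq> {0..<p}" and RS: "\<And>i. i < j \<Longrightarrow> R i \<subseteq> {0..<int p} \<and> S i \<subseteq> {0..<int p} \<and> R i \<inter> S i = {} \<and>
        card (R i) = 2 ^ i \<and> card (S i) = 2 ^ i" for U R S
    proof -
      define G where "G y = max 0 (hash_sum (\<lambda>c. indicator (R (snd y)) c - l * indicator (S (snd y)) c) (int ` U) (fst y))"
        for y :: "(int \<Rightarrow> int) \<times> nat"
      have "finite U" using U finite_subset by blast
      have pull_Int: "pull R v \<inter> U = {x \<in> U. fst (\<tau> v) (int x) \<in> R (snd (\<tau> v))}" for R v
        using U by (auto simp: pull_def)
      have "(\<Sum>v\<in>{p..<n}. max 0 (real (card (pull R v \<inter> U)) - l * real (card (pull S v \<inter> U)))) =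
          (\<Sum>v\<in>{p..<n}. G (\<tau> v))"
        by (simp add: G_def hash_sum_eq_card[OF \<open>finite U\<close>] pull_Int)
      also have "\<dots> = (\<Sum>u<n - p. G (e (u mod M)))"
        using sum.shift_bounds_nat_ivl[of "\<lambda>v. G (\<tau> v)" 0 p "n - p"] pn
        by (simp add: \<tau>_def lessThan_atLeast0)
      also have "\<dots> \<le> real k * (\<Sum>i<M. G (e i))"
        unfolding k_def using M_pos by (intro sum_mod_le) (auto simp: G_def)
      also have "(\<Sum>i<M. G (e i)) = (\<Sum>y\<in>T. G y)"
        using sum.reindex_bij_betw[OF e, of G] by (simp add: lessThan_atLeast0)
      also have "\<dots> \<le> (\<Sum>y\<in>H \<times> {..<j}. G y)"
        using finH T_sub by (intro sum_mono2) (auto simp: G_def)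
      also have "\<dots> = (\<Sum>h\<in>H. \<Sum>i<j. G (h, i))" by (simp add: sum.cartesian_product)
      also have "\<dots> \<le> real (card H) * positive_part_const l"
        unfolding H_def G_def fst_conv snd_conv using U RS
        by (intro sum_scales_positive_part_le ip(1) l(1)) auto
      finally show ?thesis by (simp add: mult_left_mono)
    qed
    have "real (bias \<eta> D) \<le> 2 * (real k * (real (card H) * positive_part_const l)) / (1 - l * \<eta>)"
      unfolding D_def
    proof (rule bias_bipartite_orientation_le[OF pn pull_sub pull_sub pull_disj])
      show "0 < l" "l * \<eta> < 1" using l by auto
    next
      fix U assume "U \<subseteq> {0..<p}"
      then show "(\<Sum>v\<in>{p..<n}. max 0 (real (card (pull P v \<inter> U)) - l * real (card (pull Q v \<inter> U))))
        \<le> real k * (real (card H) * positive_part_const l)"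
        by (rule bound) (use PQ_sub PQ in simp)
    next
      fix U assume "U \<subseteq> {0..<p}"
      then show "(\<Sum>v\<in>{p..<n}. max 0 (real (card (pull Q v \<inter> U)) - l * real (card (pull P v \<inter> U))))
        \<le> real k * (real (card H) * positive_part_const l)"
        by (rule bound) (use PQ_sub PQ in \<open>simp add: Int_commute\<close>)
    qed
    \<comment> \<open>The 4 combines \<open>k * M \<le> 2 * n\<close>, where rounding up costs one
      extra \<open>M\<close>, with \<open>card H * j \<le> 2 * M\<close>.\<close>
    also have "\<dots> \<le> 2 * (4 * (n / j) * positive_part_const l) / (1 - l * \<eta>)"
    proof (rule divide_right_mono[OF mult_left_mono])
      have "real k * M \<le> 2 * n"
      proof -
        have "k * M = (n - p) div M * M + M" by (simp add: k_def)
        also have "\<dots> \<le> (n - p) + M" by simp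
        also have "\<dots> \<le> 2 * n" using M_le n by simp
        finally show ?thesis by (metis of_nat_le_iff of_nat_mult of_nat_numeral)
      qed
      moreover have "real (card H) * j \<le> 2 * M"
        using M_ge by (metis of_nat_le_iff of_nat_mult of_nat_numeral)
      then have "real k * (real (card H) * j) \<le> real k * (2 * M)" by (rule mult_left_mono) simp
      ultimately have "real k * real (card H) * j \<le> 4 * n" by simp
      then have "real k * real (card H) \<le> 4 * (n / j)" using j by (simp add: field_simps)
      then show "real k * (real (card H) * positive_part_const l) \<le> 4 * (n / j) * positive_part_const l"
        using mult_right_mono[OF _ K0] by (simp only: mult.assoc[symmetric])
    qed (use l in auto)
    finally show ?thesis by (simp add: mult_ac)
  qed
  ultimately show ?thesis by blast
qed

text \<open>Serves the values of \<open>n\<close> too small for the construction. A star with all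
  arcs directed to its centre has \<open>n - 1\<close> arcs in total, which bounds its bias.\<close>

lemma exists_star:
  fixes \<eta> :: real
  assumes "n \<ge> 2"
  shows "\<exists>D :: nat pair_pre_digraph. oriented_graph D \<and> card (pverts D) = n \<and>
      (\<forall>v \<in> pverts D. \<not> isolated D v) \<and> real (bias \<eta> D) \<le> n"
proof -
  define D where "D = bipartite_orientation 1 n (\<lambda>_. {0}) (\<lambda>_. {})"
  have n: "1 \<le> n" using assms by simp
  have og: "oriented_graph D"
    unfolding D_def by (rule oriented_graph_bipartite_orientation[OF n]) auto
  interpret oriented_graph D by (rule og)
  have "\<forall>v \<in> pverts D. \<not> isolated D v"
    unfolding D_def by (rule no_isolated_bipartite_orientation[OF n]) (use assms in \<open>auto intro!: bexI[of _ 1]\<close>)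
  moreover have "real (bias \<eta> D) \<le> n"
  proof (rule bias_le)
    fix A B
    have "arcs_from_to D A B = (\<Sum>v\<in>{1..<n} \<inter> A. card ({0} \<inter> B))"
      unfolding D_def by (subst arcs_from_to_bipartite_orientation[OF n]) auto
    also have "\<dots> \<le> (\<Sum>v\<in>{1..<n} \<inter> A. 1)" by (intro sum_mono) (simp add: Int_insert_left)
    also have "\<dots> \<le> n" using card_mono[of "{1..<n}" "{1..<n} \<inter> A"] by simp
    finally show "real (arcs_from_to D A B) \<le> n" by simp
  qed
  moreover have "card (pverts D) = n" by (simp add: D_def bipartite_orientation_def)
  ultimately show ?thesis using og by blast
qed

theorem theorem6p2:
  fixes \<eta> :: real
  assumes "0 < \<eta>" and "\<eta> < 1"
  shows "\<exists>K :: real. \<forall>n :: nat. n \<ge> 2 \<longrightarrow>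
    (\<exists>D :: nat pair_pre_digraph. oriented_graph D \<and> card (pverts D) = n \<and>
      (\<forall>v \<in> pverts D. \<not> isolated D v) \<and>
      real (bias \<eta> D) \<le> K * (real n / log 2 (real n)))"
proof -
  \<comment> \<open>The midpoint of 1 and 1 / \<eta>, so that both \<open>l > 1\<close> and
    \<open>l * \<eta> < 1\<close> hold.\<close>
  define l where "l = (1 + \<eta>) / (2 * \<eta>)"
  have l: "l > 1" "l * \<eta> < 1" using assms by (simp_all add: l_def field_simps)
  define C where "C = 8 * positive_part_const l / (1 - l * \<eta>)"
  have C: "C \<ge> 0"
    using l positive_part_const_nonneg[OF l(1)] by (simp add: C_def)
  show ?thesis
  \<comment> \<open>The 17 covers the star, used while \<open>log 2 n\<close> is at most 17. The 26
    comes from \<open>log 2 n \<le> a + 1 \<le> 9 * j + 17 \<le> 26 * j\<close> for larger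
    \<open>n\<close>.\<close>
  proof (intro exI[of _ "17 + 26 * C"] allI impI)
    fix n :: nat assume n: "n \<ge> 2"
    then have log_pos: "log 2 n > 0" by simp
    have suff: "\<exists>D :: nat pair_pre_digraph. oriented_graph D \<and> card (pverts D) = n \<and>
      (\<forall>v \<in> pverts D. \<not> isolated D v) \<and> real (bias \<eta> D) \<le> (17 + 26 * C) * (real n / log 2 (real n))"
      if "\<exists>D :: nat pair_pre_digraph. oriented_graph D \<and> card (pverts D) = n \<and>
      (\<forall>v \<in> pverts D. \<not> isolated D v) \<and> real (bias \<eta> D) \<le> b"
        and "b \<le> (17 + 26 * C) * (real n / log 2 (real n))" for b
    proof -
      from that(1) obtain D :: "nat pair_pre_digraph" where D: "oriented_graph D" "card (pverts D) = n"
        "\<forall>v \<in> pverts D. \<not> isolated D v" "real (bias \<eta> D) \<le> b" by (elim exE conjE)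
      from D(4) that(2) have "real (bias \<eta> D) \<le> (17 + 26 * C) * (real n / log 2 (real n))"
        by (rule order.trans)
      with D(1-3) show ?thesis by (intro exI[of _ D] conjI)
    qed
    show "\<exists>D :: nat pair_pre_digraph. oriented_graph D \<and> card (pverts D) = n \<and>
      (\<forall>v \<in> pverts D. \<not> isolated D v) \<and> real (bias \<eta> D) \<le> (17 + 26 * C) * (real n / log 2 (real n))"
    proof (cases "n < 2 ^ 17")
      case True
      show ?thesis
      proof (rule suff[OF exists_star[OF n]])
        have "real n \<le> 2 ^ 17" using True by simp
        then have "log 2 n \<le> log 2 (2 ^ 17)" using n by (subst log_le_cancel_iff) auto
        also have "log 2 (2 ^ 17) = real 17" by (rule log_pow_cancel) auto
        finally have "log 2 n \<le> 17" by simp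
        then have "n * log 2 n \<le> real n * 17" by (intro mult_left_mono) auto
        then have "n \<le> 17 * (n / log 2 n)" using log_pos by (simp add: field_simps)
        also have "\<dots> \<le> (17 + 26 * C) * (n / log 2 n)"
          using C log_pos by (intro mult_right_mono) auto
        finally show "real n \<le> (17 + 26 * C) * (n / log 2 n)" .
      qed
    next
      case False
      obtain a where a: "2 ^ a \<le> n" "n < 2 ^ (a + 1)"
        using ex_power_ivl1[of 2 n] n by auto
      have "2 ^ 17 < (2::nat) ^ (a + 1)" using False a by linarith
      then have a17: "a \<ge> 17" by (subst (asm) power_strict_increasing_iff) auto
      \<comment> \<open>With \<open>p \<le> 2 ^ (2 * j + 2)\<close> and
        \<open>j + 1 \<le> 2 ^ j\<close>, the construction needs at most
        \<open>2 ^ (9 * j + 8)\<close> vertices. So \<open>j\<close> is the largest number with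
        \<open>9 * j + 8 \<le> a\<close>, and it is positive exactly from \<open>a = 17\<close>
        on.\<close>
      define j where "j = (a - 8) div 9"
      have j: "j > 0" "9 * j + 8 \<le> a" "a \<le> 9 * j + 16" using a17 unfolding j_def by linarith+
      obtain p :: nat where p: "prime p" "2 ^ j < p" "p \<le> 2 ^ (2 * j + 2)"
        using prime_between_powers_of_2 by blast
      have "p + p ^ 4 * j \<le> p ^ 4 * (j + 1)"
        using self_le_power[OF prime_ge_1_nat[OF p(1)], of 4] by simp
      also have "\<dots> \<le> (2 ^ (2 * j + 2)) ^ 4 * 2 ^ j"
        using p(3) by (intro mult_mono power_mono) (auto simp: Suc_leI)
      also have "\<dots> = 2 ^ (9 * j + 8)" unfolding power_mult[symmetric] power_add[symmetric]
        by (rule arg_cong[of _ _ "power 2"]) simp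
      also have "\<dots> \<le> 2 ^ a" using j by (intro power_increasing) auto
      also have "\<dots> \<le> n" by (rule a)
      finally have n_ge: "p + p ^ 4 * j \<le> n" .
      have "\<exists>D :: nat pair_pre_digraph. oriented_graph D \<and> card (pverts D) = n \<and>
        (\<forall>v \<in> pverts D. \<not> isolated D v) \<and> real (bias \<eta> D) \<le> C * (n / j)"
        unfolding C_def using p by (intro exists_small_bias[OF _ _ j(1) n_ge l]) auto
      then show ?thesis
      proof (rule suff)
        have "real n \<le> 2 ^ (a + 1)" using a(2) by (metis less_imp_le of_nat_le_iff of_nat_numeral of_nat_power)
        then have "log 2 n \<le> log 2 (2 ^ (a + 1))" using n by (subst log_le_cancel_iff) auto
        also have "log 2 (2 ^ (a + 1)) = real (a + 1)" by (rule log_pow_cancel) auto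
        finally have "log 2 n \<le> a + 1" by simp
        then have "log 2 n \<le> 26 * j" using j by linarith
        then have "n * log 2 n \<le> real n * (26 * real j)" by (intro mult_left_mono) auto
        then have "n / j \<le> 26 * (n / log 2 n)" using log_pos j by (simp add: field_simps)
        then have "C * (n / j) \<le> C * (26 * (n / log 2 n))" using C by (rule mult_left_mono)
        also have "\<dots> = 26 * C * (n / log 2 n)" by simp
        also have "\<dots> \<le> (17 + 26 * C) * (n / log 2 n)"
          using log_pos by (intro mult_right_mono) auto
        finally show "C * (n / j) \<le> (17 + 26 * C) * (n / log 2 n)" .
      qed
    qed
  qed
qed

end
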